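(* Let $n>3$ be odd and $m<n$ a positive integer with $\gcd(m,n)=\gcd(m-1,n)=1$. Let $k$ be a positive integer. Then $\langle L_n(m)\cup I\rangle$ contains a neutrosophic subloop of order $2(k+1)$ if and only if $k$ divides $n$.
   Context: For $n>3$ odd and $m<n$ a positive integer with $\gcd(m,n)=\gcd(m-1,n)=1$, the loop $L_n(m)$ is the set $\{e,1,2,\dots,n\}$ with operation: $e\cdot i=i\cdot e=i$ for all $i$; $i\cdot i=e$ for all $i$; and for $i,j\in\{1,\dots,n\}$, $i\neq j$, $i\cdot j$ is the element $s\in\{1,\dots,n\}$ with $s\equiv mj-(m-1)i \pmod n$. The neutrosophic loop $\langle L_n(m)\cup I\rangle$ is the set $\{e,1,\dots,n,eI,1I,\dots,nI\}$ of $2(n+1)$ distinct symbols, with the product of $L_n(m)$ on $\{e,1,\dots,n\}$ and $x\cdot(yI)=(xI)\cdot y=(xI)\cdot(yI)=(x\cdot y)I$ for $x,y\in L_n(m)$. A neutrosophic subloop is a subset of the form $P\cup\{xI:x\in P\}$, where $P$ is a subloop of $L_n(m)$; the whole $\langle L_n(m)\cup I\rangle$ is allowed. The order is the number of elements. *)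

theory Defs
  imports "HOL-Algebra.Group" "HOL-Number_Theory.Cong"
begin

text \<open>
  The record type of \<open>HOL-Algebra.Group\<close> (carrier, product, unit) only supplies the
  signature; associativity is not assumed for loops.
\<close>

locale loop =
  fixes L (structure)
  assumes m_closed: "\<lbrakk>x \<in> carrier L; y \<in> carrier L\<rbrakk> \<Longrightarrow> x \<otimes> y \<in> carrier L"
    and one_closed: "\<one> \<in> carrier L"
    and l_one: "x \<in> carrier L \<Longrightarrow> \<one> \<otimes> x = x"
    and r_one: "x \<in> carrier L \<Longrightarrow> x \<otimes> \<one> = x"
    and l_div: "\<lbrakk>a \<in> carrier L; b \<in> carrier L\<rbrakk> \<Longrightarrow> \<exists>!x. x \<in> carrier L \<and> a \<otimes> x = b"
    and r_div: "\<lbrakk>a \<in> carrier L; b \<in> carrier L\<rbrakk> \<Longrightarrow> \<exists>!y. y \<in> carrier L \<and> y \<otimes> a = b"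

definition subloop :: "'a set \<Rightarrow> ('a, 'b) monoid_scheme \<Rightarrow> bool" where
  "subloop P L \<longleftrightarrow> P \<subseteq> carrier L \<and> loop (L\<lparr>carrier := P\<rparr>)"

datatype loop_elem = E | El nat

fun Ln_mult :: "nat \<Rightarrow> nat \<Rightarrow> loop_elem \<Rightarrow> loop_elem \<Rightarrow> loop_elem" where
  "Ln_mult n m E y = y"
| "Ln_mult n m (El i) E = El i"
| "Ln_mult n m (El i) (El j) =
     (if i = j then E
      else El (THE s. s \<in> {1..n} \<and>
                 [int s = int m * int j - (int m - 1) * int i] (mod int n)))"

definition Ln :: "nat \<Rightarrow> nat \<Rightarrow> loop_elem monoid" where
  "Ln n m = \<lparr>carrier = insert E (El ` {1..n}), monoid.mult = Ln_mult n m, monoid.one = E\<rparr>"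

text \<open>\<open>Plain x\<close> stands for the symbol \<open>x\<close> and \<open>Indet x\<close> for the symbol \<open>xI\<close>.\<close>

datatype 'a neutrosophic = Plain 'a | Indet 'a

fun neutrosophic_mult ::
  "('a \<Rightarrow> 'a \<Rightarrow> 'a) \<Rightarrow> 'a neutrosophic \<Rightarrow> 'a neutrosophic \<Rightarrow> 'a neutrosophic" where
  "neutrosophic_mult f (Plain x) (Plain y) = Plain (f x y)"
| "neutrosophic_mult f (Plain x) (Indet y) = Indet (f x y)"
| "neutrosophic_mult f (Indet x) (Plain y) = Indet (f x y)"
| "neutrosophic_mult f (Indet x) (Indet y) = Indet (f x y)"

definition neutrosophic_loop :: "'a monoid \<Rightarrow> 'a neutrosophic monoid" where
  "neutrosophic_loop L =
     \<lparr>carrier = Plain ` carrier L \<union> Indet ` carrier L,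
      monoid.mult = neutrosophic_mult (monoid.mult L),
      monoid.one = Plain (monoid.one L)\<rparr>"

definition neutrosophic_subloop :: "'a neutrosophic set \<Rightarrow> 'a monoid \<Rightarrow> bool" where
  "neutrosophic_subloop N L \<longleftrightarrow>
     N \<subseteq> carrier (neutrosophic_loop L) \<and>
     (\<exists>P. subloop P L \<and> N = Plain ` P \<union> Indet ` P)"

end

theory Submission
  imports Defs "HOL-Algebra.Elementary_Groups"
begin

text \<open>
  A subloop of \<open>L\<^sub>n(m)\<close> is \<open>{e} \<union> S\<close> for a set \<open>S\<close> of residues modulo \<open>n\<close>, and off the diagonal
  the product of \<open>L\<^sub>n(m)\<close> is the affine map \<open>(i, j) \<mapsto> (1 - m) i + m j\<close>, whose value for \<open>i = j\<close>
  would be \<open>i\<close>, so \<open>S\<close> is closed under the affine map without exception. It is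
  also closed under division by it. Given \<open>x, y, z \<in> S\<close>, solve
  \<open>(1 - m) x' + m z = x\<close> and \<open>(1 - m) z + m y' = y\<close> in \<open>S\<close>; then the affine map takes \<open>(x', y')\<close> to
  \<open>x + y - z\<close>. A nonempty set of residues closed under \<open>x + y - z\<close> is a coset of a subgroup of
  \<open>\<int>/n\<int>\<close>, so by Lagrange its size divides \<open>n\<close> (\<open>subloop_Ln_heap\<close>, \<open>card_heap_dvd\<close>).

  Conversely, if \<open>k\<close> divides \<open>n\<close>, then the \<open>k\<close> multiples of \<open>n / k\<close> form a subgroup, which is closed
  under the affine map. Since \<open>m\<close> and \<open>m - 1\<close> are units modulo \<open>n\<close>, the loop \<open>L\<^sub>n(m)\<close> is
  cancellative on both sides, and a finite closed subset of a cancellative structure is closed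
  under division (\<open>Ln_left_cancel\<close>, \<open>Ln_right_cancel\<close>, \<open>loop_if_finite_cancel\<close>).

  Passing to the neutrosophic loop only doubles the cardinality.
\<close>

section \<open>The product of two indices\<close>

lemma residue_representative_unique:
  assumes "s \<in> {1..n}" "t \<in> {1..n}" "[int s = int t] (mod int n)"
  shows "s = t"
proof -
  have "int n dvd int s - int t" using assms(3) by (simp add: cong_iff_dvd_diff)
  moreover have "\<bar>int s - int t\<bar> < int n" using assms(1,2) by auto
  ultimately have "int s - int t = 0" using dvd_imp_le_int[of "int s - int t" "int n"] by linarith
  then show ?thesis by simp
qed

lemma residue_representative_exists:
  assumes "n > 0"
  shows "\<exists>s\<in>{1..n}. [int s = z] (mod int n)"
proof (intro bexI)
  \<comment> \<open>Shifting by one before and after reduction turns \<open>{0..<n}\<close> into \<open>{1..n}\<close>.\<close>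
  let ?s = "nat ((z - 1) mod int n) + 1"
  have "int ?s = (z - 1) mod int n + 1" using assms by simp
  moreover have "[(z - 1) mod int n + 1 = (z - 1) + 1] (mod int n)"
    by (intro cong_add) (auto simp: cong_def)
  ultimately show "[int ?s = z] (mod int n)" by (simp only: diff_add_cancel)
  have "(z - 1) mod int n < int n" using assms by simp
  with \<open>int ?s = _\<close> have "int ?s \<le> int n" by linarith
  then have "?s \<le> n" by (simp only: of_nat_le_iff)
  then show "?s \<in> {1..n}" by simp
qed

text \<open>Introduces the representative selected by the definite description in the product.\<close>

lemma Ln_mult_distinctE:
  assumes "n > 0" "i \<noteq> j"
  obtains s where "s \<in> {1..n}" "Ln_mult n m (El i) (El j) = El s"
    "[int s = (1 - int m) * int i + int m * int j] (mod int n)"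
proof -
  let ?P = "\<lambda>s. s \<in> {1..n} \<and> [int s = int m * int j - (int m - 1) * int i] (mod int n)"
  obtain s where s: "?P s" using residue_representative_exists[OF assms(1)] by blast
  have "t = s" if "?P t" for t
    using that s by (intro residue_representative_unique) (auto simp: cong_def)
  with s have "(THE s. ?P s) = s" by (rule the_equality)
  with s assms(2) show ?thesis by (intro that[of s]) (auto simp: algebra_simps)
qed

section \<open>Subloops are cosets\<close>

text \<open>
  Subtracting a fixed base point \<open>z \<in> S\<close> turns \<open>S\<close> into a subgroup of \<open>\<int>/n\<int>\<close>: the closure
  hypothesis with base point \<open>z\<close> gives sums, and with \<open>z, z, x\<close> it gives \<open>2z - x\<close>, the negative
  of \<open>x\<close> relative to \<open>z\<close>.
\<close>

lemma card_heap_dvd: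
  assumes n: "n > 0" and S: "S \<subseteq> {1..n}" and ne: "S \<noteq> {}"
    and heap: "\<And>x y z. \<lbrakk>x \<in> S; y \<in> S; z \<in> S\<rbrakk> \<Longrightarrow>
        \<exists>w\<in>S. [int w = int x + int y - int z] (mod int n)"
  shows "card S dvd n"
proof -
  obtain z where z: "z \<in> S" using ne by blast
  define f where "f x = (int x - int z) mod int n" for x
  interpret G: group "integer_mod_group n" by (rule group_integer_mod_group)
  have carr: "carrier (integer_mod_group n) = {0..<int n}"
    using n by (simp add: carrier_integer_mod_group)
  have f_in: "f x \<in> {0..<int n}" for x using n by (simp add: f_def)
  have f_cong: "f w = a mod int n" if "[int w = a + int z] (mod int n)" for w a
    using cong_diff[OF that cong_refl[of "int z"]] by (simp add: f_def cong_def)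
  have "subgroup (f ` S) (integer_mod_group n)"
  proof (rule G.subgroupI)
    show "f ` S \<subseteq> carrier (integer_mod_group n)" using f_in carr by auto
    show "f ` S \<noteq> {}" using ne by simp
  next
    fix a assume "a \<in> f ` S"
    then obtain x where x: "x \<in> S" "a = f x" by blast
    obtain w where w: "w \<in> S" "[int w = int z + int z - int x] (mod int n)"
      using heap[OF z z x(1)] by blast
    have "f w = (- (int x - int z)) mod int n" using w(2) by (intro f_cong) (simp add: algebra_simps)
    also have "\<dots> = (- a) mod int n" by (simp add: x(2) f_def mod_minus_eq)
    also have "\<dots> = inv\<^bsub>integer_mod_group n\<^esub> a"
      using f_in[of x] n by (simp add: x(2) carr)
    finally show "inv\<^bsub>integer_mod_group n\<^esub> a \<in> f ` S" using w(1) by (metis imageI)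
  next
    fix a b assume "a \<in> f ` S" "b \<in> f ` S"
    then obtain x y where x: "x \<in> S" "a = f x" and y: "y \<in> S" "b = f y" by blast
    obtain w where w: "w \<in> S" "[int w = int x + int y - int z] (mod int n)"
      using heap[OF x(1) y(1) z] by blast
    have "f w = ((int x - int z) + (int y - int z)) mod int n"
      using w(2) by (intro f_cong) (simp add: algebra_simps)
    also have "\<dots> = a \<otimes>\<^bsub>integer_mod_group n\<^esub> b"
      by (simp add: x(2) y(2) f_def mod_add_eq mult_integer_mod_group)
    finally show "a \<otimes>\<^bsub>integer_mod_group n\<^esub> b \<in> f ` S" using w(1) by (metis imageI)
  qed
  then have "card (f ` S) dvd order (integer_mod_group n)"
    using G.lagrange by (metis dvd_triv_right)
  moreover have "inj_on f S"
  proof (rule inj_onI)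
    fix x y assume "x \<in> S" "y \<in> S" "f x = f y"
    moreover from \<open>f x = f y\<close> have "[int x = int y] (mod int n)"
      using cong_add[of "int x - int z" "int y - int z" "int n" "int z" "int z"]
      by (simp add: f_def cong_def)
    ultimately show "x = y" using S residue_representative_unique by blast
  qed
  ultimately show ?thesis by (simp add: card_image order_def carr)
qed

text \<open>
  The set of indices in \<open>P\<close> inherits division by the affine map from division in the loop \<open>P\<close>. For
  \<open>b \<noteq> i\<close> the quotient of \<open>El b\<close> by \<open>El i\<close> is an index other than \<open>i\<close>, because \<open>El i\<close> times \<open>E\<close> is
  \<open>El i\<close> and \<open>El i\<close> times itself is \<open>E\<close>. For \<open>b = i\<close> the loop quotient is \<open>E\<close>, but the affine map has
  the solution \<open>i\<close>. Dividing \<open>x\<close> and \<open>y\<close> by \<open>z\<close> on opposite sides cancels the coefficients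
  \<open>m\<close> and \<open>1 - m\<close>.
\<close>

lemma subloop_Ln_heap:
  assumes n: "n > 0" and P: "subloop P (Ln n m)"
    and xyz: "El x \<in> P" "El y \<in> P" "El z \<in> P"
  shows "\<exists>w. El w \<in> P \<and> [int w = int x + int y - int z] (mod int n)"
proof -
  interpret loop "(Ln n m)\<lparr>carrier := P\<rparr>" using P by (simp add: subloop_def)
  have closed: "\<exists>s. El s \<in> P \<and> [int s = (1 - int m) * int i + int m * int j] (mod int n)"
    if "El i \<in> P" "El j \<in> P" for i j
  proof (cases "i = j")
    case True
    then show ?thesis using that by (intro exI[of _ i]) (simp add: algebra_simps)
  next
    case False
    from n False obtain s where s: "Ln_mult n m (El i) (El j) = El s"
      "[int s = (1 - int m) * int i + int m * int j] (mod int n)"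
      by (rule Ln_mult_distinctE)
    with m_closed[of "El i" "El j"] that show ?thesis by (auto simp: Ln_def)
  qed
  have left: "\<exists>j. El j \<in> P \<and> [int b = (1 - int m) * int i + int m * int j] (mod int n)"
    if "El i \<in> P" "El b \<in> P" for i b
  proof (cases "b = i")
    case True
    then show ?thesis using that by (intro exI[of _ i]) (simp add: algebra_simps)
  next
    case False
    from l_div[of "El i" "El b"] that obtain u where u: "u \<in> P" "Ln_mult n m (El i) u = El b"
      by (auto simp: Ln_def)
    with False obtain j where j: "u = El j" "i \<noteq> j" by (cases u) (auto split: if_splits)
    from n j(2) obtain s where "Ln_mult n m (El i) (El j) = El s"
      "[int s = (1 - int m) * int i + int m * int j] (mod int n)"
      by (rule Ln_mult_distinctE)
    with u j show ?thesis by auto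
  qed
  have right: "\<exists>i. El i \<in> P \<and> [int b = (1 - int m) * int i + int m * int j] (mod int n)"
    if "El j \<in> P" "El b \<in> P" for j b
  proof (cases "b = j")
    case True
    then show ?thesis using that by (intro exI[of _ j]) (simp add: algebra_simps)
  next
    case False
    from r_div[of "El j" "El b"] that obtain u where u: "u \<in> P" "Ln_mult n m u (El j) = El b"
      by (auto simp: Ln_def)
    with False obtain i where i: "u = El i" "i \<noteq> j" by (cases u) (auto split: if_splits)
    from n i(2) obtain s where "Ln_mult n m (El i) (El j) = El s"
      "[int s = (1 - int m) * int i + int m * int j] (mod int n)"
      by (rule Ln_mult_distinctE)
    with u i show ?thesis by auto
  qed
  obtain x' where x': "El x' \<in> P" "[int x = (1 - int m) * int x' + int m * int z] (mod int n)"
    using right xyz by blast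
  obtain y' where y': "El y' \<in> P" "[int y = (1 - int m) * int z + int m * int y'] (mod int n)"
    using left xyz by blast
  obtain w where w: "El w \<in> P" "[int w = (1 - int m) * int x' + int m * int y'] (mod int n)"
    using closed x'(1) y'(1) by blast
  have "[int x + int y - int z = ((1 - int m) * int x' + int m * int z)
      + ((1 - int m) * int z + int m * int y') - int z] (mod int n)"
    using x'(2) y'(2) by (intro cong_add cong_diff cong_refl)
  then have "[int x + int y - int z = (1 - int m) * int x' + int m * int y'] (mod int n)"
    by (simp add: algebra_simps)
  with w show ?thesis by (metis cong_sym cong_trans)
qed

section \<open>Subloops from divisors\<close>

text \<open>
  On a finite closed set, an injective translation is a permutation, which is exactly unique
  divisibility.
\<close>

lemma loop_if_finite_cancel:
  fixes L (structure)
  assumes fin: "finite (carrier L)"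
    and closed: "\<And>x y. \<lbrakk>x \<in> carrier L; y \<in> carrier L\<rbrakk> \<Longrightarrow> x \<otimes> y \<in> carrier L"
    and one: "\<one> \<in> carrier L"
    and units: "\<And>x. x \<in> carrier L \<Longrightarrow> \<one> \<otimes> x = x" "\<And>x. x \<in> carrier L \<Longrightarrow> x \<otimes> \<one> = x"
    and left: "\<And>a x y. \<lbrakk>a \<in> carrier L; x \<in> carrier L; y \<in> carrier L; a \<otimes> x = a \<otimes> y\<rbrakk> \<Longrightarrow> x = y"
    and right: "\<And>a x y. \<lbrakk>a \<in> carrier L; x \<in> carrier L; y \<in> carrier L; x \<otimes> a = y \<otimes> a\<rbrakk> \<Longrightarrow> x = y"
  shows "loop L"
proof
  fix a b assume ab: "a \<in> carrier L" "b \<in> carrier L"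
  have "inj_on (\<lambda>x. a \<otimes> x) (carrier L)" using left[OF ab(1)] by (rule inj_onI)
  then have "(\<lambda>x. a \<otimes> x) ` carrier L = carrier L"
    using closed[OF ab(1)] by (intro endo_inj_surj[OF fin]) blast+
  then have "b \<in> (\<lambda>x. a \<otimes> x) ` carrier L" using ab(2) by simp
  then obtain x where "x \<in> carrier L" "a \<otimes> x = b" by blast
  then show "\<exists>!x. x \<in> carrier L \<and> a \<otimes> x = b" using left[OF ab(1)] by blast
  have "inj_on (\<lambda>x. x \<otimes> a) (carrier L)" using right[OF ab(1)] by (rule inj_onI)
  then have "(\<lambda>x. x \<otimes> a) ` carrier L = carrier L"
    using closed[OF _ ab(1)] by (intro endo_inj_surj[OF fin]) blast+
  then have "b \<in> (\<lambda>x. x \<otimes> a) ` carrier L" using ab(2) by simp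
  then obtain y where "y \<in> carrier L" "y \<otimes> a = b" by blast
  then show "\<exists>!y. y \<in> carrier L \<and> y \<otimes> a = b" using right[OF ab(1)] by blast
qed (fact closed one units)+

lemma cong_mult_unit_cancel:
  fixes u a b c N :: int
  assumes "coprime u N" "[u * a + c = u * b + c] (mod N)"
  shows "[a = b] (mod N)"
  using assms by (metis cong_add_rcancel cong_mult_lcancel)

text \<open>
  The products by \<open>E\<close> do not create collisions: the value \<open>E\<close> is taken only on the diagonal, and
  since the affine map fixes the diagonal, a product of \<open>El i\<close> with another index that gave \<open>El i\<close>
  again would be a collision of the affine map, which cancelling the unit \<open>m\<close> excludes.
\<close>

lemma Ln_left_cancel:
  assumes n: "n > 0" and m: "coprime (int m) (int n)"
    and C: "a \<in> carrier (Ln n m)" "x \<in> carrier (Ln n m)" "y \<in> carrier (Ln n m)"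
    and eq: "Ln_mult n m a x = Ln_mult n m a y"
  shows "x = y"
proof (cases a)
  case E
  then show ?thesis using eq by simp
next
  case (El i)
  have idx: "p = q"
    if "p \<in> {1..n}" "q \<in> {1..n}"
      "[(1 - int m) * int i + int m * int p = (1 - int m) * int i + int m * int q] (mod int n)"
    for p q
    using residue_representative_unique[OF that(1,2)] that(3)
      cong_mult_unit_cancel[OF m, of "int p" "(1 - int m) * int i" "int q"]
    by (simp add: add.commute)
  have i: "i \<in> {1..n}" using C(1) El by (auto simp: Ln_def)
  have only_E: "u = E" if u: "u \<in> carrier (Ln n m)" "Ln_mult n m (El i) u = El i" for u
  proof (rule ccontr)
    assume "u \<noteq> E"
    with u obtain j where j: "u = El j" "j \<in> {1..n}" "i \<noteq> j"
      by (auto simp: Ln_def split: if_splits)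
    from n j(3) obtain s where "Ln_mult n m (El i) (El j) = El s"
      "[int s = (1 - int m) * int i + int m * int j] (mod int n)"
      by (rule Ln_mult_distinctE)
    with u(2) j(1) have "[(1 - int m) * int i + int m * int i
        = (1 - int m) * int i + int m * int j] (mod int n)"
      by (simp add: algebra_simps)
    then show False using idx i j by blast
  qed
  show ?thesis
  proof (cases "x = E \<or> y = E")
    case True
    then have "Ln_mult n m (El i) x = El i" using eq El by auto
    then show ?thesis using only_E[of x] only_E[of y] C eq El by simp
  next
    case False
    with C obtain p q where xy: "x = El p" "y = El q" and pq: "p \<in> {1..n}" "q \<in> {1..n}"
      by (auto simp: Ln_def)
    show ?thesis
    proof (cases "i = p \<or> i = q")
      case True
      then show ?thesis using eq El xy by (auto split: if_splits)
    next
      case False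
      then have "i \<noteq> p" "i \<noteq> q" by auto
      from n \<open>i \<noteq> p\<close> obtain s where s: "Ln_mult n m (El i) (El p) = El s"
        "[int s = (1 - int m) * int i + int m * int p] (mod int n)"
        by (rule Ln_mult_distinctE)
      from n \<open>i \<noteq> q\<close> obtain t where t: "Ln_mult n m (El i) (El q) = El t"
        "[int t = (1 - int m) * int i + int m * int q] (mod int n)"
        by (rule Ln_mult_distinctE)
      have "s = t" using eq s(1) t(1) El xy by simp
      then have "p = q" using idx[OF pq] s(2) t(2) by (metis cong_sym cong_trans)
      then show ?thesis using xy by simp
    qed
  qed
qed

text \<open>
  Exchanging the factors replaces \<open>m\<close> by \<open>1 - m\<close> in the affine map, which is represented by the
  natural number \<open>n + 1 - m\<close>. So right cancellation is left cancellation in the opposite loop.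
\<close>

lemma Ln_mult_opposite:
  assumes "m \<le> n"
  shows "Ln_mult n m x y = Ln_mult n (n + 1 - m) y x"
proof (cases x; cases y)
  fix i j assume xy: "x = El i" "y = El j"
  have "int (n + 1 - m) * int i - (int (n + 1 - m) - 1) * int j
      = (int m * int j - (int m - 1) * int i) + int n * (int i - int j)"
    using assms by (simp add: algebra_simps)
  then have "[a = int m * int j - (int m - 1) * int i] (mod int n) \<longleftrightarrow>
      [a = int (n + 1 - m) * int i - (int (n + 1 - m) - 1) * int j] (mod int n)" for a
    by (simp add: cong_def)
  then show ?thesis by (cases "i = j") (simp_all add: xy)
qed auto

lemma Ln_right_cancel:
  assumes n: "n > 0" and "m \<le> n" and m: "coprime (1 - int m) (int n)"
    and C: "a \<in> carrier (Ln n m)" "x \<in> carrier (Ln n m)" "y \<in> carrier (Ln n m)"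
    and eq: "Ln_mult n m x a = Ln_mult n m y a"
  shows "x = y"
proof (rule Ln_left_cancel[OF n])
  have "[1 - int m = int (n + 1 - m)] (mod int n)"
    using \<open>m \<le> n\<close> by (simp add: of_nat_diff cong_iff_dvd_diff)
  then show "coprime (int (n + 1 - m)) (int n)" using m cong_imp_coprime by blast
  show "Ln_mult n (n + 1 - m) a x = Ln_mult n (n + 1 - m) a y"
    using eq by (simp only: Ln_mult_opposite[OF \<open>m \<le> n\<close>])
qed (use C in \<open>simp_all add: Ln_def\<close>)

lemma subloop_Ln_multiples:
  assumes n: "n > 0" and "m \<le> n" and d: "d dvd n"
    and m: "coprime (int m) (int n)" and m1: "coprime (1 - int m) (int n)"
  shows "subloop (insert E (El ` {i \<in> {1..n}. d dvd i})) (Ln n m)"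
proof -
  let ?P = "insert E (El ` {i \<in> {1..n}. d dvd i})"
  have sub: "?P \<subseteq> carrier (Ln n m)" by (auto simp: Ln_def)
  have prod: "Ln_mult n m (El i) (El j) \<in> ?P" if ij: "d dvd i" "d dvd j" for i j
  proof (cases "i = j")
    case False
    with n obtain s where s: "s \<in> {1..n}" "Ln_mult n m (El i) (El j) = El s"
      "[int s = (1 - int m) * int i + int m * int j] (mod int n)"
      by (rule Ln_mult_distinctE)
    have "[int s = (1 - int m) * int i + int m * int j] (mod int d)"
      using s(3) d by (meson cong_dvd_modulus int_dvd_int_iff)
    moreover have "int d dvd (1 - int m) * int i + int m * int j" using ij by simp
    ultimately have "d dvd s" by (metis cong_dvd_iff int_dvd_int_iff)
    with s show ?thesis by auto
  qed simp
  have closed: "Ln_mult n m x y \<in> ?P" if "x \<in> ?P" "y \<in> ?P" for x y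
    using that prod by (cases x; cases y) (auto simp del: Ln_mult.simps(3))
  have "loop ((Ln n m)\<lparr>carrier := ?P\<rparr>)"
  proof (rule loop_if_finite_cancel)
    show "x = y" if "a \<in> carrier ((Ln n m)\<lparr>carrier := ?P\<rparr>)" "x \<in> carrier ((Ln n m)\<lparr>carrier := ?P\<rparr>)"
      "y \<in> carrier ((Ln n m)\<lparr>carrier := ?P\<rparr>)"
      "a \<otimes>\<^bsub>(Ln n m)\<lparr>carrier := ?P\<rparr>\<^esub> x = a \<otimes>\<^bsub>(Ln n m)\<lparr>carrier := ?P\<rparr>\<^esub> y" for a x y
      using that sub by (intro Ln_left_cancel[OF n m, of a x y]) (auto simp: Ln_def)
    show "x = y" if "a \<in> carrier ((Ln n m)\<lparr>carrier := ?P\<rparr>)" "x \<in> carrier ((Ln n m)\<lparr>carrier := ?P\<rparr>)"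
      "y \<in> carrier ((Ln n m)\<lparr>carrier := ?P\<rparr>)"
      "x \<otimes>\<^bsub>(Ln n m)\<lparr>carrier := ?P\<rparr>\<^esub> a = y \<otimes>\<^bsub>(Ln n m)\<lparr>carrier := ?P\<rparr>\<^esub> a" for a x y
      using that sub by (intro Ln_right_cancel[OF n \<open>m \<le> n\<close> m1, of a x y]) (auto simp: Ln_def)
    show "x \<otimes>\<^bsub>(Ln n m)\<lparr>carrier := ?P\<rparr>\<^esub> y \<in> carrier ((Ln n m)\<lparr>carrier := ?P\<rparr>)"
      if "x \<in> carrier ((Ln n m)\<lparr>carrier := ?P\<rparr>)" "y \<in> carrier ((Ln n m)\<lparr>carrier := ?P\<rparr>)" for x y
      using that closed by (simp add: Ln_def)
  qed (auto simp: Ln_def)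
  with sub show ?thesis by (simp add: subloop_def)
qed

section \<open>Orders of neutrosophic subloops\<close>

lemma card_Plain_Un_Indet:
  assumes "finite P"
  shows "card (Plain ` P \<union> Indet ` P) = 2 * card P"
proof -
  have "card (Plain ` P \<union> Indet ` P) = card (Plain ` P) + card (Indet ` P)"
    using assms by (intro card_Un_disjoint) auto
  also have "\<dots> = 2 * card P" by (simp add: card_image inj_on_def)
  finally show ?thesis .
qed

lemma card_insert_E_El:
  assumes "finite S"
  shows "card (insert E (El ` S)) = card S + 1"
proof -
  have "E \<notin> El ` S" by auto
  then show ?thesis using assms by (simp add: card_image inj_on_def)
qed

theorem theorem4p1p3:
  fixes n m k :: nat
  assumes "n > 3" and "odd n"
    and "0 < m" and "m < n"
    and "gcd m n = 1" and "gcd (m - 1) n = 1"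
    and "k > 0"
  shows "(\<exists>N. neutrosophic_subloop N (Ln n m) \<and> card N = 2 * (k + 1)) \<longleftrightarrow> k dvd n"
proof
  assume "\<exists>N. neutrosophic_subloop N (Ln n m) \<and> card N = 2 * (k + 1)"
  then obtain P where P: "subloop P (Ln n m)" and card: "card (Plain ` P \<union> Indet ` P) = 2 * (k + 1)"
    unfolding neutrosophic_subloop_def by blast
  define S where "S = {i. El i \<in> P}"
  have sub: "P \<subseteq> insert E (El ` {1..n})" using P by (auto simp: subloop_def Ln_def)
  then have fin: "finite P" by (rule finite_subset) simp
  have S: "S \<subseteq> {1..n}" using sub by (auto simp: S_def)
  have "E \<in> P" using P loop.one_closed[of "(Ln n m)\<lparr>carrier := P\<rparr>"] by (simp add: subloop_def Ln_def)
  then have P_eq: "P = insert E (El ` S)" using sub by (auto simp: S_def)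
  have "card S = k"
    using card card_Plain_Un_Indet[OF fin] card_insert_E_El[OF finite_subset[OF S]] P_eq by simp
  moreover have "card S dvd n"
  proof (rule card_heap_dvd[OF _ S])
    show "S \<noteq> {}" using \<open>card S = k\<close> \<open>k > 0\<close> by auto
    show "\<exists>w\<in>S. [int w = int x + int y - int z] (mod int n)" if "x \<in> S" "y \<in> S" "z \<in> S" for x y z
      using subloop_Ln_heap[OF _ P, of x y z] that \<open>n > 3\<close> by (auto simp: S_def)
  qed (use \<open>n > 3\<close> in simp)
  ultimately show "k dvd n" by simp
next
  assume "k dvd n"
  then obtain d where d: "n = d * k" by (metis dvd_def mult.commute)
  then have "d > 0" using \<open>n > 3\<close> by (cases d) auto
  define S where "S = {i \<in> {1..n}. d dvd i}"
  have "S = (\<lambda>t. d * t) ` {1..k}" using \<open>d > 0\<close> d by (auto simp: S_def elim!: dvdE)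
  then have "card S = k" using \<open>d > 0\<close> by (simp add: card_image inj_on_def)
  have m: "coprime (int m) (int n)" using \<open>gcd m n = 1\<close> by (simp add: coprime_iff_gcd_eq_1)
  have "coprime (int (m - 1)) (int n)" using \<open>gcd (m - 1) n = 1\<close> by (simp add: coprime_iff_gcd_eq_1)
  moreover have "1 - int m = - int (m - 1)" using \<open>0 < m\<close> by simp
  ultimately have m1: "coprime (1 - int m) (int n)" by (metis coprime_minus_left_iff)
  let ?P = "insert E (El ` S)"
  have P: "subloop ?P (Ln n m)"
    unfolding S_def
  proof (rule subloop_Ln_multiples[OF _ _ _ m m1])
    show "n > 0" "m \<le> n" using \<open>n > 3\<close> \<open>m < n\<close> by simp_all
    show "d dvd n" using d by (rule dvdI)
  qed
  have "finite S" by (simp add: S_def)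
  have "card (Plain ` ?P \<union> Indet ` ?P) = 2 * (k + 1)"
    using \<open>finite S\<close> \<open>card S = k\<close> by (subst card_Plain_Un_Indet) (simp_all add: card_insert_E_El)
  moreover have "neutrosophic_subloop (Plain ` ?P \<union> Indet ` ?P) (Ln n m)"
    unfolding neutrosophic_subloop_def
  proof
    show "Plain ` ?P \<union> Indet ` ?P \<subseteq> carrier (neutrosophic_loop (Ln n m))"
      using P unfolding subloop_def neutrosophic_loop_def by auto
    show "\<exists>Q. subloop Q (Ln n m) \<and> Plain ` ?P \<union> Indet ` ?P = Plain ` Q \<union> Indet ` Q"
      using P by blast
  qed
  ultimately show "\<exists>N. neutrosophic_subloop N (Ln n m) \<and> card N = 2 * (k + 1)" by blast
qed

end
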